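(* Let $n\ge1$ and let $A_n$ be the $2^n$-dimensional locally-complex Cayley--Dickson algebra over $\mathbb{R}$. Then every monic quadratic general polynomial $f(x)=x^2+f_1(x)+r$ over $A_n$ has a zero in $A_n$, i.e. there exists $\lambda\in A_n$ with $f(\lambda)=0$.
   Context: Locally-complex Cayley--Dickson algebras: start with $A_0=\mathbb{R}$ with trivial involution, and for $k\ge1$ let $A_k=A_{k-1}\oplus A_{k-1}\ell_k$ with product $(q+r\ell_k)(s+t\ell_k)=qs-\bar t r+(tq+r\bar s)\ell_k$ and involution $\overline{q+r\ell_k}=\bar q-r\ell_k$ (the Cayley--Dickson doubling with parameter $-1$ at every step). The locally-complex Cayley--Dickson algebras are the algebras $A_n$, $n\ge1$: $A_1=\mathbb{C}$, $A_2=\mathbb{H}$ (quaternions), $A_3=\mathbb{O}$ (octonions), $A_4=\mathbb{S}$ (sedenions), and so on. A monic quadratic general polynomial over $A_n$ is an expression $f(x)=x^2+f_1(x)+r$ with $r\in A_n$ and $f_1(x)$ a finite sum of linear terms, where a linear term is a product of elements of $A_n$ and precisely one occurrence of $x$, in any order and with any bracketing (the variable neither commutes nor associates with the coefficients). It is evaluated at $\lambda\in A_n$ by substituting $x=\lambda$. *)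

theory Defs
  imports Complex_Main
begin

text \<open>
  All the algebras \<open>A\<^sub>n\<close> live in one type: an element of \<open>A\<^sub>n\<close> is a full binary tree of depth \<open>n\<close>
  with real leaves, \<open>Dbl q r\<close> being \<open>q + r \<ell>\<^sub>k\<close> with \<open>q, r \<in> A\<^bsub>k-1\<^esub>\<close>.  Trees that are not full belong
  to no \<open>A\<^sub>n\<close>, and the binary operations are unspecified on arguments of different shape.
\<close>

datatype cd = Base real | Dbl cd cd

primrec cd_alg :: "nat \<Rightarrow> cd set" where
  "cd_alg 0 = range Base"
| "cd_alg (Suc k) = {Dbl q r | q r. q \<in> cd_alg k \<and> r \<in> cd_alg k}"

primrec cd_zero :: "nat \<Rightarrow> cd" where
  "cd_zero 0 = Base 0"
| "cd_zero (Suc k) = Dbl (cd_zero k) (cd_zero k)"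

instantiation cd :: "{plus, uminus, minus}"
begin

fun plus_cd :: "cd \<Rightarrow> cd \<Rightarrow> cd" where
  "Base a + Base b = Base (a + b)"
| "Dbl q r + Dbl s t = Dbl (q + s) (r + t)"
| "_ + (_ :: cd) = undefined"

primrec uminus_cd :: "cd \<Rightarrow> cd" where
  "- Base a = Base (- a)"
| "- Dbl q r = Dbl (- q) (- r)"

definition minus_cd :: "cd \<Rightarrow> cd \<Rightarrow> cd" where
  "x - y = x + (- y :: cd)"

instance ..

end

primrec cd_conj :: "cd \<Rightarrow> cd" where
  "cd_conj (Base a) = Base a"
| "cd_conj (Dbl q r) = Dbl (cd_conj q) (- r)"

lemma size_uminus_cd [simp]: "size (- x :: cd) = size x"
  by (induction x) auto

lemma size_cd_conj [simp]: "size (cd_conj x) = size x"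
  by (induction x) auto

instantiation cd :: times
begin

function times_cd :: "cd \<Rightarrow> cd \<Rightarrow> cd" where
  "Base a * Base b = Base (a * b)"
| "Dbl q r * Dbl s t = Dbl (q * s - cd_conj t * r) (t * q + r * cd_conj s)"
| "Base a * Dbl s t = undefined"
| "Dbl q r * Base b = undefined"
  by pat_completeness auto
termination
  by (relation "measure (\<lambda>(x, y). size x + size y)") auto

instance ..

end

lemma cd_zero_in_cd_alg: "cd_zero n \<in> cd_alg n"
  by (induction n) auto

lemma cd_plus_in_cd_alg: "x \<in> cd_alg n \<Longrightarrow> y \<in> cd_alg n \<Longrightarrow> x + y \<in> cd_alg n"
  by (induction n arbitrary: x y) fastforce+

lemma cd_uminus_in_cd_alg: "x \<in> cd_alg n \<Longrightarrow> - x \<in> cd_alg n"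
  by (induction n arbitrary: x) auto

lemma cd_minus_in_cd_alg: "x \<in> cd_alg n \<Longrightarrow> y \<in> cd_alg n \<Longrightarrow> x - y \<in> cd_alg n"
  by (simp add: minus_cd_def cd_plus_in_cd_alg cd_uminus_in_cd_alg)

lemma cd_conj_in_cd_alg: "x \<in> cd_alg n \<Longrightarrow> cd_conj x \<in> cd_alg n"
  by (induction n arbitrary: x) (auto simp: cd_uminus_in_cd_alg)

lemma cd_times_in_cd_alg: "x \<in> cd_alg n \<Longrightarrow> y \<in> cd_alg n \<Longrightarrow> x * y \<in> cd_alg n"
  by (induction n arbitrary: x y)
     (auto simp: cd_conj_in_cd_alg intro!: cd_plus_in_cd_alg cd_minus_in_cd_alg)

lemma cd_alg_1_times_complex:
  "Dbl (Base (Re z)) (Base (Im z)) * Dbl (Base (Re w)) (Base (Im w))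
     = Dbl (Base (Re (z * w))) (Base (Im (z * w)))"
  by (simp add: minus_cd_def algebra_simps)

text \<open>
  General polynomials are formal, fully bracketed expressions, because the variable neither
  commutes nor associates with the coefficients.
\<close>

datatype gpoly = Var | Coeff cd | Plus gpoly gpoly | Times gpoly gpoly

primrec gpoly_eval :: "gpoly \<Rightarrow> cd \<Rightarrow> cd" where
  "gpoly_eval Var x = x"
| "gpoly_eval (Coeff a) x = a"
| "gpoly_eval (Plus f g) x = gpoly_eval f x + gpoly_eval g x"
| "gpoly_eval (Times f g) x = gpoly_eval f x * gpoly_eval g x"

text \<open>\<open>monomial n d f\<close>: \<open>f\<close> is a product, in any order and with any bracketing, of elements of \<open>A\<^sub>n\<close>
  and exactly \<open>d\<close> occurrences of the variable.\<close>

inductive monomial :: "nat \<Rightarrow> nat \<Rightarrow> gpoly \<Rightarrow> bool" for n :: nat where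
  "monomial n 1 Var"
| "a \<in> cd_alg n \<Longrightarrow> monomial n 0 (Coeff a)"
| "monomial n d f \<Longrightarrow> monomial n e g \<Longrightarrow> monomial n (d + e) (Times f g)"

definition linear_term :: "nat \<Rightarrow> gpoly \<Rightarrow> bool" where
  "linear_term n f \<longleftrightarrow> monomial n 1 f"

definition gpoly_sum :: "nat \<Rightarrow> gpoly list \<Rightarrow> gpoly" where
  "gpoly_sum n fs = foldr Plus fs (Coeff (cd_zero n))"

definition monic_quadratic :: "nat \<Rightarrow> gpoly \<Rightarrow> bool" where
  "monic_quadratic n f \<longleftrightarrow>
     (\<exists>fs r. (\<forall>g \<in> set fs. linear_term n g) \<and> r \<in> cd_alg n \<and>
       f = Plus (Plus (Times Var Var) (gpoly_sum n fs)) (Coeff r))"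

end

theory Submission
  imports Defs "Jordan_Normal_Form.Char_Poly"
begin

text \<open>
  In real coordinates \<open>x\<^sup>2 = 2 x\<^sub>0 x - \<bar>x\<bar>\<^sup>2\<close>, and the linear part of \<open>f\<close> is an arbitrary real matrix.  For a
  fixed real part \<open>a\<close>, the imaginary part of \<open>f(a + v) = 0\<close> is therefore a linear system
  \<open>(a - A) v = a w + c\<close> in \<open>m = 2\<^sup>n - 1\<close> unknowns, while the real part is a scalar equation \<open>h(a, v) = 0\<close>
  with \<open>h\<close> tending to \<open>- \<infinity>\<close> as \<open>\<bar>v\<bar> \<rightarrow> \<infinity>\<close> for bounded \<open>a\<close>.  As \<open>m\<close> is odd, \<open>A\<close> has a largest real eigenvalue
  \<open>e\<close>.  On \<open>a > e\<close> the system has a unique solution \<open>v(a)\<close>, which is continuous and bounded at infinity, so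
  \<open>h(a, v(a)) \<rightarrow> \<infinity>\<close>.  If \<open>h(a, v(a))\<close> never vanishes it is positive throughout; then \<open>v(a)\<close> stays bounded
  as \<open>a \<rightarrow> e\<close> and has a limit point \<open>v\<^sub>0\<close>, which solves the system at \<open>e\<close> with \<open>h(e, v\<^sub>0) \<ge> 0\<close>.  Adding a large
  multiple of an eigenvector to \<open>v\<^sub>0\<close> makes \<open>h\<close> negative, so \<open>h\<close> has a zero on that line.
\<close>

subsection \<open>Real linear algebra\<close>

lemma odd_degree_poly_root:
  fixes p :: "real poly"
  assumes "odd (degree p)" "lead_coeff p > 0"
  shows "\<exists>x. poly p x = 0"
proof -
  obtain b where b: "poly p x > 0" if "x \<ge> b" for x
    using poly_pinfty_gt_lc[OF assms(2)] assms(2) by (meson less_le_trans)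
  \<comment> \<open>\<open>?q\<close> is \<open>- p (- x)\<close>. Odd degree makes its leading
    coefficient positive, so the same growth fact shows that \<open>p\<close> is negative far to the
    left.\<close>
  let ?q = "- pcompose p [:0, -1:]"
  have "lead_coeff ?q > 0"
    using lead_coeff_comp[of "[:0, -1:]" p] assms by simp
  then obtain c where c: "poly ?q x > 0" if "x \<ge> c" for x
    using poly_pinfty_gt_lc[of ?q] by (meson less_le_trans)
  define d where "d = max 1 (max b c)"
  have "poly p (- d) < 0"
    using c[of d] by (simp add: d_def poly_pcompose)
  moreover have "poly p d > 0"
    using b[of d] by (simp add: d_def)
  moreover have "d \<ge> 1"
    by (simp add: d_def)
  ultimately show ?thesis
    using poly_IVT_pos[of "- d" d p] by auto
qed

lemma eigenvalue_odd_dim: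
  fixes A :: "real mat"
  assumes "A \<in> carrier_mat m m" "odd m"
  shows "\<exists>k. eigenvalue A k"
  using odd_degree_poly_root[of "char_poly A"] degree_monic_char_poly[OF assms(1)] assms(2)
  by (auto simp: eigenvalue_root_char_poly[OF assms(1)])

lemma finite_eigenvalues:
  fixes A :: "'a :: field mat"
  assumes "A \<in> carrier_mat m m"
  shows "finite {k. eigenvalue A k}"
proof -
  have "char_poly A \<noteq> 0"
    using degree_monic_char_poly[OF assms] by auto
  then show ?thesis
    by (simp add: eigenvalue_root_char_poly[OF assms] poly_roots_finite)
qed

lemma continuous_on_det:
  fixes A :: "'a :: topological_space \<Rightarrow> 'b :: {real_normed_algebra_1, comm_ring_1} mat"
  assumes "\<And>t. A t \<in> carrier_mat m m"
    and "\<And>i j. i < m \<Longrightarrow> j < m \<Longrightarrow> continuous_on S (\<lambda>t. A t $$ (i, j))"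
  shows "continuous_on S (\<lambda>t. det (A t))"
proof -
  have "continuous_on S (\<lambda>t. \<Sum>p | p permutes {0..<m}. signof p * (\<Prod>i = 0..<m. A t $$ (i, p i)))"
    by (intro continuous_on_sum continuous_on_mult continuous_on_const continuous_on_prod assms(2))
       (auto simp: permutes_in_image)
  then show ?thesis
    using carrier_matD[OF assms(1)] by (simp add: det_def)
qed

lemma continuous_on_adj_mat:
  fixes A :: "'a :: topological_space \<Rightarrow> 'b :: {real_normed_algebra_1, comm_ring_1} mat"
  assumes A: "\<And>t. A t \<in> carrier_mat m m"
    and c: "\<And>i j. i < m \<Longrightarrow> j < m \<Longrightarrow> continuous_on S (\<lambda>t. A t $$ (i, j))"
    and "i < m" "j < m"
  shows "continuous_on S (\<lambda>t. adj_mat (A t) $$ (i, j))"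
proof -
  \<comment> \<open>Entry \<open>(i, j)\<close> of the adjugate is the cofactor at
    \<open>(j, i)\<close>, hence the swapped indices.\<close>
  have "continuous_on S (\<lambda>t. det (mat_delete (A t) j i))"
  proof (rule continuous_on_det)
    show "mat_delete (A t) j i \<in> carrier_mat (m - 1) (m - 1)" for t
      by (rule mat_delete_carrier[OF A])
    fix i' j' assume "i' < m - 1" "j' < m - 1"
    then show "continuous_on S (\<lambda>t. mat_delete (A t) j i $$ (i', j'))"
      using carrier_matD[OF A] by (simp add: mat_delete_def c)
  qed
  then show ?thesis
    using carrier_matD[OF A] assms(3,4)
    by (simp add: adj_mat_def cofactor_def continuous_on_mult)
qed

text \<open>Cramer's rule: the solution is the adjugate applied to the right-hand side, divided by
  the determinant, so its coordinates are quotients of continuous functions of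
  \<open>a\<close>.\<close>

lemma continuous_resolvent:
  fixes A :: "real mat"
  assumes A: "A \<in> carrier_mat m m" and w: "w \<in> carrier_vec m" and c: "c \<in> carrier_vec m"
    and U: "\<And>a. a \<in> U \<Longrightarrow> \<not> eigenvalue A a"
  obtains v where
    "\<And>a. v a \<in> carrier_vec m"
    "\<And>a. a \<in> U \<Longrightarrow> a \<cdot>\<^sub>v v a = A *\<^sub>v v a + (a \<cdot>\<^sub>v w + c)"
    "\<And>i. i < m \<Longrightarrow> continuous_on U (\<lambda>a. v a $ i)"
proof
  define C where "C = char_matrix A"
  have C: "C a \<in> carrier_mat m m" for a
    using A by (simp add: C_def)
  have C_cont: "continuous_on U (\<lambda>a. C a $$ (i, j))" if "i < m" "j < m" for i j
    using that A by (auto simp: C_def char_matrix_def intro!: continuous_intros)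
  have det: "det (C a) \<noteq> 0" if "a \<in> U" for a
    using U[OF that] by (simp add: C_def eigenvalue_det[OF A])
  define b where "b a = - (a \<cdot>\<^sub>v w + c)" for a
  have b: "b a \<in> carrier_vec m" for a
    using w c by (simp add: b_def)
  \<comment> \<open>Where \<open>det (C a) = 0\<close> the inverse is 0 by convention, so
    \<open>v a\<close> is the zero vector and still has dimension \<open>m\<close>.\<close>
  define v where "v a = inverse (det (C a)) \<cdot>\<^sub>v (adj_mat (C a) *\<^sub>v b a)" for a
  note adj = adj_mat(1)[OF C]
  show v: "v a \<in> carrier_vec m" for a
    using adj[of a] b[of a] by (simp add: v_def)
  show "a \<cdot>\<^sub>v v a = A *\<^sub>v v a + (a \<cdot>\<^sub>v w + c)" if "a \<in> U" for a
  proof -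
    have "C a *\<^sub>v v a = inverse (det (C a)) \<cdot>\<^sub>v ((C a * adj_mat (C a)) *\<^sub>v b a)"
      using C[of a] adj[of a] b[of a] by (simp add: v_def mult_mat_vec[of _ m m])
    also have "\<dots> = b a"
      using adj_mat(2)[OF C, of a] b[of a] det[OF that]
      by (auto simp: smult_smult_assoc intro!: eq_vecI)
    finally have "C a *\<^sub>v v a = b a" .
    moreover have "C a *\<^sub>v v a = A *\<^sub>v v a - a \<cdot>\<^sub>v v a"
      using A v[of a] by (auto simp: C_def char_matrix_def add_mult_distrib_mat_vec[of _ m m])
    ultimately have eq: "(A *\<^sub>v v a - a \<cdot>\<^sub>v v a) $ i = (b a) $ i" for i
      by simp
    show ?thesis
    proof (rule eq_vecI)
      fix i assume "i < dim_vec (A *\<^sub>v v a + (a \<cdot>\<^sub>v w + c))"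
      then show "(a \<cdot>\<^sub>v v a) $ i = (A *\<^sub>v v a + (a \<cdot>\<^sub>v w + c)) $ i"
        using eq[of i] A v[of a] w c by (simp add: b_def)
    qed (use A v[of a] w c in auto)
  qed
  show "continuous_on U (\<lambda>a. v a $ i)" if i: "i < m" for i
  proof -
    have eq: "v a $ i = inverse (det (C a)) *
        (\<Sum>j = 0..<m. adj_mat (C a) $$ (i, j) * - (a * w $ j + c $ j))" for a
      using adj[of a] b[of a] i w c
      by (auto simp: v_def scalar_prod_def b_def intro!: sum.cong)
    show ?thesis
      unfolding eq
      by (intro continuous_intros continuous_on_det[OF C C_cont]
          continuous_on_adj_mat[OF C C_cont]) (use i det in auto)
  qed
qed

section \<open>Compactness and norm estimates\<close>

text \<open>Bolzano-Weierstrass, one coordinate at a time: a monotone subsequence of the new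
  coordinate converges because it is bounded, and the earlier coordinates keep their limits along
  it.\<close>

lemma bounded_coords_convergent_subsequence:
  fixes x :: "nat \<Rightarrow> real vec"
  assumes "\<And>i k. i < m \<Longrightarrow> \<bar>x k $ i\<bar> \<le> B"
  shows "\<exists>s l. strict_mono (s :: nat \<Rightarrow> nat) \<and> (\<forall>i<m. (\<lambda>k. x (s k) $ i) \<longlonglongrightarrow> l i)"
  using assms
proof (induction m)
  case 0
  show ?case
    by (rule exI[of _ id]) (simp add: strict_mono_def)
next
  case (Suc m)
  then obtain s l where s: "strict_mono (s :: nat \<Rightarrow> nat)"
    and l: "\<And>i. i < m \<Longrightarrow> (\<lambda>k. x (s k) $ i) \<longlonglongrightarrow> l i"
    by fastforce
  obtain s' where s': "strict_mono (s' :: nat \<Rightarrow> nat)" "monoseq (\<lambda>k. x (s (s' k)) $ m)"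
    using seq_monosub[of "\<lambda>k. x (s k) $ m"] by auto
  have "Bseq (\<lambda>k. x (s (s' k)) $ m)"
    by (rule BseqI'[of _ B]) (use Suc.prems in auto)
  then obtain r where r: "(\<lambda>k. x (s (s' k)) $ m) \<longlonglongrightarrow> r"
    using Bseq_monoseq_convergent s'(2) by (auto simp: convergent_def)
  have "(\<lambda>k. x (s (s' k)) $ i) \<longlonglongrightarrow> (l(m := r)) i" if "i < Suc m" for i
    using that r LIMSEQ_subseq_LIMSEQ[OF l s'(1), of i]
    by (auto simp: o_def less_Suc_eq)
  then show ?case
    using strict_mono_o[OF s s'(1)] by (intro exI[of _ "s \<circ> s'"] exI[of _ "l(m := r)"]) (auto simp: o_def)
qed

text \<open>Quadratic formula: the signs of \<open>K\<close> and \<open>h\<close> make the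
  discriminant \<open>b^2 + 4 K h\<close> nonnegative.\<close>

lemma quadratic_concave_root:
  fixes K b h :: real
  assumes "K > 0" "h \<ge> 0"
  shows "\<exists>t. h + b * t - K * t\<^sup>2 = 0"
proof -
  have "0 \<le> b\<^sup>2 + 4 * K * h"
    using assms by simp
  then have "(sqrt (b\<^sup>2 + 4 * K * h))\<^sup>2 = b\<^sup>2 + 4 * K * h"
    by simp
  then have "h + b * ((b + sqrt (b\<^sup>2 + 4 * K * h)) / (2 * K))
      - K * ((b + sqrt (b\<^sup>2 + 4 * K * h)) / (2 * K))\<^sup>2 = 0"
    using assms by (simp add: field_simps power2_eq_square)
  then show ?thesis ..
qed

text \<open>The arithmetic-geometric mean inequality in each coordinate. This form lets a term
  linear in a vector be absorbed into its squared length.\<close>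

lemma abs_scalar_prod_le:
  fixes x y :: "real vec"
  assumes "x \<in> carrier_vec m" "y \<in> carrier_vec m"
  shows "\<bar>x \<bullet> y\<bar> \<le> (x \<bullet> x + y \<bullet> y) / 2"
proof -
  have "\<bar>x \<bullet> y\<bar> \<le> (\<Sum>i = 0..<m. \<bar>x $ i * y $ i\<bar>)"
    using assms by (simp add: scalar_prod_def)
  also have "\<dots> \<le> (\<Sum>i = 0..<m. (x $ i * x $ i + y $ i * y $ i) / 2)"
  proof (rule sum_mono)
    fix i
    have "0 \<le> (\<bar>x $ i\<bar> - \<bar>y $ i\<bar>)\<^sup>2"
      by simp
    then show "\<bar>x $ i * y $ i\<bar> \<le> (x $ i * x $ i + y $ i * y $ i) / 2"
      by (simp add: power2_eq_square algebra_simps abs_mult)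
  qed
  also have "\<dots> = (x \<bullet> x + y \<bullet> y) / 2"
    using assms by (simp add: scalar_prod_def sum.distrib flip: sum_divide_distrib)
  finally show ?thesis .
qed

lemma index_square_le_scalar_prod:
  fixes x :: "real vec"
  assumes "i < dim_vec x"
  shows "(x $ i)\<^sup>2 \<le> x \<bullet> x"
  unfolding scalar_prod_def power2_eq_square
  by (rule member_le_sum) (use assms in auto)

lemma scalar_prod_self_nonneg: "0 \<le> (x :: real vec) \<bullet> x"
  by (simp add: scalar_prod_def sum_nonneg)

lemma scalar_prod_self_pos:
  fixes x :: "real vec"
  assumes "x \<in> carrier_vec m" "x \<noteq> 0\<^sub>v m"
  shows "0 < x \<bullet> x"
proof -
  obtain i where "i < m" "x $ i \<noteq> 0"
    using assms by (metis carrier_vecD eq_vecI index_zero_vec)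
  then show ?thesis
    using index_square_le_scalar_prod[of i x] assms(1)
    by (metis carrier_vecD less_le_trans zero_less_power2)
qed

lemma quadratic_form_bounded:
  fixes A :: "real mat"
  assumes A: "A \<in> carrier_mat m m"
  obtains K where "K \<ge> 0" "\<And>v. v \<in> carrier_vec m \<Longrightarrow> v \<bullet> (A *\<^sub>v v) \<le> K * (v \<bullet> v)"
proof
  let ?K = "\<Sum>i = 0..<m. \<Sum>j = 0..<m. \<bar>A $$ (i, j)\<bar>"
  show "?K \<ge> 0"
    by (simp add: sum_nonneg)
  fix v :: "real vec" assume v: "v \<in> carrier_vec m"
  have "v \<bullet> (A *\<^sub>v v) = (\<Sum>i = 0..<m. \<Sum>j = 0..<m. A $$ (i, j) * (v $ i * v $ j))"
    using A v by (auto simp: scalar_prod_def sum_distrib_left mult_ac intro!: sum.cong)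
  also have "\<dots> \<le> (\<Sum>i = 0..<m. \<Sum>j = 0..<m. \<bar>A $$ (i, j)\<bar> * (v \<bullet> v))"
  proof (intro sum_mono)
    fix i j assume ij: "i \<in> {0..<m}" "j \<in> {0..<m}"
    have "0 \<le> (\<bar>v $ i\<bar> - \<bar>v $ j\<bar>)\<^sup>2"
      by simp
    then have "\<bar>v $ i * v $ j\<bar> \<le> ((v $ i)\<^sup>2 + (v $ j)\<^sup>2) / 2"
      by (simp add: power2_eq_square algebra_simps abs_mult)
    also have "\<dots> \<le> v \<bullet> v"
      using index_square_le_scalar_prod[of i v] index_square_le_scalar_prod[of j v] ij v by simp
    finally have "\<bar>A $$ (i, j)\<bar> * \<bar>v $ i * v $ j\<bar> \<le> \<bar>A $$ (i, j)\<bar> * (v \<bullet> v)"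
      by (rule mult_left_mono) simp
    then show "A $$ (i, j) * (v $ i * v $ j) \<le> \<bar>A $$ (i, j)\<bar> * (v \<bullet> v)"
      by (simp flip: abs_mult)
  qed
  finally show "v \<bullet> (A *\<^sub>v v) \<le> ?K * (v \<bullet> v)"
    by (simp add: sum_distrib_right)
qed

text \<open>Pair the equation with \<open>v\<close>: for large \<open>a\<close> the left side
  \<open>a (v \<bullet> v)\<close> dominates every term in \<open>v \<bullet> v\<close> on the
  right, which leaves a bound independent of \<open>a\<close>.\<close>

lemma resolvent_bounded_at_infinity:
  fixes A :: "real mat"
  assumes A: "A \<in> carrier_mat m m" and w: "w \<in> carrier_vec m" and c: "c \<in> carrier_vec m"
  obtains a0 B where "\<And>a v. a \<ge> a0 \<Longrightarrow> v \<in> carrier_vec m \<Longrightarrow>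
    a \<cdot>\<^sub>v v = A *\<^sub>v v + (a \<cdot>\<^sub>v w + c) \<Longrightarrow> v \<bullet> v \<le> B"
proof -
  obtain K where K: "K \<ge> 0" "\<And>v. v \<in> carrier_vec m \<Longrightarrow> v \<bullet> (A *\<^sub>v v) \<le> K * (v \<bullet> v)"
    using quadratic_form_bounded[OF A] by blast
  show ?thesis
  proof
    \<comment> \<open>The threshold gives \<open>a \<ge> 1\<close> and
      \<open>K + 1/2 \<le> a/4\<close>: half of \<open>a (v \<bullet> v)\<close> absorbs the cross
      term with \<open>w\<close>, a quarter absorbs those from \<open>A\<close> and
      \<open>c\<close>, and a quarter is left.\<close>
    fix a v assume a: "a \<ge> 4 * K + 2" and v: "v \<in> carrier_vec m"
      and eq: "a \<cdot>\<^sub>v v = A *\<^sub>v v + (a \<cdot>\<^sub>v w + c)"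
    have "a * (v \<bullet> v) = v \<bullet> (a \<cdot>\<^sub>v v)"
      using v by simp
    also have "\<dots> = v \<bullet> (A *\<^sub>v v) + (a * (v \<bullet> w) + v \<bullet> c)"
      unfolding eq using A v w c by (simp add: scalar_prod_add_distrib[of _ m])
    also have "\<dots> \<le> K * (v \<bullet> v) + (a * ((v \<bullet> v + w \<bullet> w) / 2) + (v \<bullet> v + c \<bullet> c) / 2)"
      using K v abs_scalar_prod_le[OF v w] abs_scalar_prod_le[OF v c] a
      by (intro add_mono mult_left_mono) auto
    finally have "(a / 2) * (v \<bullet> v) \<le> (K + 1 / 2) * (v \<bullet> v) + (a * (w \<bullet> w) + c \<bullet> c) / 2"
      by (simp add: field_simps)
    also have "(K + 1 / 2) * (v \<bullet> v) \<le> (a / 4) * (v \<bullet> v)"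
      using a scalar_prod_self_nonneg[of v] by (intro mult_right_mono) auto
    also have "c \<bullet> c \<le> a * (c \<bullet> c)"
      using a K(1) scalar_prod_self_nonneg[of c] mult_right_mono[of 1 a "c \<bullet> c"] by auto
    finally have "a * (v \<bullet> v) \<le> a * (2 * (w \<bullet> w + c \<bullet> c))"
      by (simp add: field_simps)
    then show "v \<bullet> v \<le> 2 * (w \<bullet> w + c \<bullet> c)"
      using a K(1) by simp
  qed
qed

lemma scalar_prod_tendsto:
  fixes x y :: "'a \<Rightarrow> real vec"
  assumes "\<And>k. x k \<in> carrier_vec m" "\<And>k. y k \<in> carrier_vec m" "x' \<in> carrier_vec m" "y' \<in> carrier_vec m"
    and "\<And>i. i < m \<Longrightarrow> ((\<lambda>k. x k $ i) \<longlongrightarrow> x' $ i) F"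
    and "\<And>i. i < m \<Longrightarrow> ((\<lambda>k. y k $ i) \<longlongrightarrow> y' $ i) F"
  shows "((\<lambda>k. x k \<bullet> y k) \<longlongrightarrow> x' \<bullet> y') F"
proof -
  have "((\<lambda>k. \<Sum>i = 0..<m. x k $ i * y k $ i) \<longlongrightarrow> (\<Sum>i = 0..<m. x' $ i * y' $ i)) F"
    by (intro tendsto_sum tendsto_mult assms) auto
  then show ?thesis
    by (simp add: scalar_prod_def carrier_vecD[OF assms(2)] carrier_vecD[OF assms(4)])
qed

section \<open>The zero in real coordinates\<close>

text \<open>\<open>a\<close> and \<open>v\<close> are the real and imaginary parts of a zero; the
  pencil is the imaginary equation, the quadric the real one. If they never met, \<open>h\<close>
  would be positive on the solution branch beyond the last real eigenvalue, and this positivity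
  forces a meeting at that eigenvalue.\<close>

lemma pencil_quadric_intersect:
  fixes A :: "real mat" and \<alpha> \<rho> :: real
  assumes "odd m" and A: "A \<in> carrier_mat m m"
    and w: "w \<in> carrier_vec m" and c: "c \<in> carrier_vec m" and p: "p \<in> carrier_vec m"
  shows "\<exists>a v. v \<in> carrier_vec m \<and> a \<cdot>\<^sub>v v = A *\<^sub>v v + (a \<cdot>\<^sub>v w + c) \<and>
    a\<^sup>2 - v \<bullet> v + \<alpha> * a + p \<bullet> v + \<rho> = 0"
proof (rule ccontr)
  define h where "h a v = a\<^sup>2 - v \<bullet> v + \<alpha> * a + p \<bullet> v + \<rho>" for a v
  define sol where "sol a v \<longleftrightarrow> v \<in> carrier_vec m \<and> a \<cdot>\<^sub>v v = A *\<^sub>v v + (a \<cdot>\<^sub>v w + c)" for a v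
  assume "\<not> ?thesis"
  then have no_zero: "h a v \<noteq> 0" if "sol a v" for a v
    using that by (auto simp: h_def sol_def)

  \<comment> \<open>Beyond the largest real eigenvalue the system is uniquely solvable on a whole
    interval, as the intermediate value theorem will require.\<close>
  define e where "e = Max {k. eigenvalue A k}"
  have e: "eigenvalue A e" and e_max: "\<And>a. a \<in> {e<..} \<Longrightarrow> \<not> eigenvalue A a"
    using eigenvalue_odd_dim[OF A \<open>odd m\<close>] finite_eigenvalues[OF A]
      Max_in[of "{k. eigenvalue A k}"] Max_ge[of "{k. eigenvalue A k}"]
    by (force simp: e_def not_less[symmetric])+
  obtain v where v: "\<And>a. v a \<in> carrier_vec m"
    and v_eq: "\<And>a. a \<in> {e<..} \<Longrightarrow> a \<cdot>\<^sub>v v a = A *\<^sub>v v a + (a \<cdot>\<^sub>v w + c)"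
    and v_cont: "\<And>i. i < m \<Longrightarrow> continuous_on {e<..} (\<lambda>a. v a $ i)"
    using continuous_resolvent[OF A w c e_max] by blast
  have sol_v: "sol a (v a)" if "a > e" for a
    using v v_eq that by (simp add: sol_def)
  have h_cont: "continuous_on {e<..} (\<lambda>a. h a (v a))"
    unfolding h_def continuous_on_def
    by (intro ballI tendsto_intros scalar_prod_tendsto[of _ m] v p)
       (use v_cont in \<open>auto simp: continuous_on_def\<close>)

  \<comment> \<open>The lower bound shows growth in \<open>a\<close> when \<open>v\<close> is
    bounded; the upper one bounds \<open>v\<close> when \<open>h\<close> is positive.\<close>
  have h_ge: "h a v \<ge> a\<^sup>2 + \<alpha> * a - 3 / 2 * (v \<bullet> v) - (p \<bullet> p) / 2 + \<rho>"
    and h_le: "h a v \<le> a\<^sup>2 + \<alpha> * a - 1 / 2 * (v \<bullet> v) + (p \<bullet> p) / 2 + \<rho>"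
    if "v \<in> carrier_vec m" for a v
    using abs_scalar_prod_le[OF p that] by (simp_all add: h_def field_simps)

  obtain a0 B where B: "\<And>a v. a \<ge> a0 \<Longrightarrow> sol a v \<Longrightarrow> v \<bullet> v \<le> B"
    using resolvent_bounded_at_infinity[OF A w c] unfolding sol_def by metis
  have h_large: "\<exists>a\<ge>b. h a (v a) > 0" if "b > e" for b
  proof -
    \<comment> \<open>\<open>D\<close> collects the constants of the lower bound. The choice of
      \<open>a\<close> below gives \<open>a \<ge> 1\<close> and
      \<open>a + \<alpha> \<ge> D + 1\<close>, so \<open>a (a + \<alpha>)\<close> exceeds
      \<open>D\<close>.\<close>
    define D where "D = \<bar>3 / 2 * B + (p \<bullet> p) / 2 - \<rho>\<bar>"
    define a where "a = max (max a0 b) (\<bar>\<alpha>\<bar> + D + 1)"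
    have a: "a \<ge> a0" "a \<ge> b" "a \<ge> \<bar>\<alpha>\<bar> + D + 1"
      by (auto simp: a_def)
    have "D \<ge> 0"
      by (simp add: D_def)
    then have "a \<ge> 1"
      using a(3) by linarith
    have "D + 1 \<le> a * (D + 1)"
      using \<open>a \<ge> 1\<close> \<open>D \<ge> 0\<close> mult_right_mono[of 1 a "D + 1"] by simp
    also have "\<dots> \<le> a * (a + \<alpha>)"
      using a(3) \<open>a \<ge> 1\<close> by (intro mult_left_mono) auto
    finally have "D < a\<^sup>2 + \<alpha> * a"
      by (simp add: power2_eq_square algebra_simps)
    moreover have "v a \<bullet> v a \<le> B"
      using B[OF a(1) sol_v] a(2) that by simp
    ultimately have "h a (v a) > 0"
      using h_ge[OF v, of a a] by (auto simp: D_def)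
    then show ?thesis
      using a(2) by blast
  qed
  \<comment> \<open>A nonpositive value at \<open>a\<close> and a positive one further right would
    give a zero of \<open>h\<close> on the branch, which \<open>no_zero\<close> excludes.\<close>
  have h_pos: "h a (v a) > 0" if a: "a > e" for a
  proof (rule ccontr)
    assume "\<not> h a (v a) > 0"
    moreover obtain b where b: "b \<ge> a" "h b (v b) > 0"
      using h_large[OF a] by blast
    ultimately obtain x where "x \<ge> a" "h x (v x) = 0"
      using IVT'[of "\<lambda>a. h a (v a)" a 0 b] continuous_on_subset[OF h_cont, of "{a..b}"] a
      by (force simp: not_less)
    then show False
      using no_zero sol_v a by fastforce
  qed

  \<comment> \<open>Positivity of \<open>h\<close> keeps the branch from blowing up near
    \<open>e\<close>, where the system becomes singular.\<close>
  have v_bounded: "v a \<bullet> v a \<le> 2 * ((\<bar>e\<bar> + 1)\<^sup>2 + \<bar>\<alpha>\<bar> * (\<bar>e\<bar> + 1)) + p \<bullet> p + 2 * \<rho>"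
    if "a > e" "a \<le> e + 1" for a
  proof -
    have a: "\<bar>a\<bar> \<le> \<bar>e\<bar> + 1"
      using that by linarith
    then have "a\<^sup>2 \<le> (\<bar>e\<bar> + 1)\<^sup>2"
      by (simp add: abs_le_square_iff[symmetric])
    moreover have "\<alpha> * a \<le> \<bar>\<alpha>\<bar> * (\<bar>e\<bar> + 1)"
      using mult_mono[OF order_refl a, of "\<bar>\<alpha>\<bar>"] abs_ge_self[of "\<alpha> * a"] by (simp add: abs_mult)
    ultimately show ?thesis
      using h_pos[OF that(1)] h_le[OF v, of a a] by simp
  qed
  define a where "a k = e + 1 / real (Suc k)" for k
  have a_gt: "a k > e" and "a k \<le> e + 1" for k
    by (simp_all add: a_def)
  obtain B' where B': "v (a k) \<bullet> v (a k) \<le> B'" for k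
    using v_bounded[OF a_gt \<open>\<And>k. a k \<le> e + 1\<close>] by blast
  have "\<bar>v (a k) $ i\<bar> \<le> sqrt B'" if "i < m" for i k
    using index_square_le_scalar_prod[of i "v (a k)"] B'[of k] that v[of "a k"]
    by (intro real_le_rsqrt) auto
  then obtain s l where s: "strict_mono s"
    and l: "\<And>i. i < m \<Longrightarrow> (\<lambda>k. v (a (s k)) $ i) \<longlonglongrightarrow> l i"
    using bounded_coords_convergent_subsequence[of m "\<lambda>k. v (a k)" "sqrt B'"] by blast
  have "a \<longlonglongrightarrow> e + 0"
    unfolding a_def by (intro tendsto_intros LIMSEQ_Suc lim_1_over_n)
  then have a_lim: "(\<lambda>k. a (s k)) \<longlonglongrightarrow> e"
    using LIMSEQ_subseq_LIMSEQ[OF _ s] by (simp add: o_def)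
  define v0 where "v0 = vec m l"
  have v0: "v0 \<in> carrier_vec m" and v0_lim: "\<And>i. i < m \<Longrightarrow> (\<lambda>k. v (a (s k)) $ i) \<longlonglongrightarrow> v0 $ i"
    using l by (simp_all add: v0_def)
  have "sol e v0"
    unfolding sol_def
  proof (intro conjI v0 eq_vecI)
    fix i assume "i < dim_vec (A *\<^sub>v v0 + (e \<cdot>\<^sub>v w + c))"
    then have i: "i < m"
      using c by simp
    have eq: "a k * v (a k) $ i = row A i \<bullet> v (a k) + (a k * w $ i + c $ i)" for k
      using arg_cong[OF conjunct2[OF sol_v[OF a_gt, of k, unfolded sol_def]], of "\<lambda>x. x $ i"]
        i A w c v[of "a k"] by simp
    have "(\<lambda>k. a (s k) * v (a (s k)) $ i) \<longlonglongrightarrow> e * v0 $ i"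
      by (intro tendsto_intros a_lim v0_lim i)
    moreover have "(\<lambda>k. a (s k) * v (a (s k)) $ i) \<longlonglongrightarrow> row A i \<bullet> v0 + (e * w $ i + c $ i)"
      unfolding eq
      by (intro tendsto_intros a_lim scalar_prod_tendsto[of _ m]) (use A i v v0 v0_lim in auto)
    ultimately have "e * v0 $ i = row A i \<bullet> v0 + (e * w $ i + c $ i)"
      by (rule LIMSEQ_unique)
    then show "(e \<cdot>\<^sub>v v0) $ i = (A *\<^sub>v v0 + (e \<cdot>\<^sub>v w + c)) $ i"
      using A w c v0 i by simp
  qed (use v0 c in auto)
  have "(\<lambda>k. h (a (s k)) (v (a (s k)))) \<longlonglongrightarrow> h e v0"
    unfolding h_def by (intro tendsto_intros a_lim scalar_prod_tendsto[of _ m] v v0 p v0_lim)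
  then have h0: "h e v0 \<ge> 0"
    using h_pos[OF a_gt] by (intro LIMSEQ_le_const) (auto intro: less_imp_le)

  \<comment> \<open>Every \<open>v0 + t u\<close> solves the system at \<open>e\<close>. Along this
    line \<open>h\<close> is a quadratic in \<open>t\<close> with leading coefficient
    \<open>- (u \<bullet> u) < 0\<close> and nonnegative value at \<open>t = 0\<close>, hence it has
    a zero.\<close>
  obtain u where u: "u \<in> carrier_vec m" "u \<noteq> 0\<^sub>v m" "A *\<^sub>v u = e \<cdot>\<^sub>v u"
    using e A by (auto simp: eigenvalue_def eigenvector_def)
  obtain t where t: "h e v0 + (p \<bullet> u - 2 * (v0 \<bullet> u)) * t - (u \<bullet> u) * t\<^sup>2 = 0"
    using quadratic_concave_root[OF scalar_prod_self_pos[OF u(1,2)] h0] by blast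
  have "h e (v0 + t \<cdot>\<^sub>v u) = h e v0 + (p \<bullet> u - 2 * (v0 \<bullet> u)) * t - (u \<bullet> u) * t\<^sup>2"
    using p u v0 comm_scalar_prod[OF u(1) v0]
    by (simp add: h_def scalar_prod_add_distrib[of _ m] add_scalar_prod_distrib[of _ m]
        power2_eq_square algebra_simps)
  moreover have "sol e (v0 + t \<cdot>\<^sub>v u)"
  proof -
    have "e \<cdot>\<^sub>v (v0 + t \<cdot>\<^sub>v u) = e \<cdot>\<^sub>v v0 + t \<cdot>\<^sub>v (A *\<^sub>v u)"
      unfolding u(3) using u v0 by (auto simp: algebra_simps)
    also have "\<dots> = A *\<^sub>v (v0 + t \<cdot>\<^sub>v u) + (e \<cdot>\<^sub>v w + c)"
      using \<open>sol e v0\<close> A u(1) v0 w c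
      by (auto simp: sol_def mult_add_distrib_mat_vec[of _ m m] mult_mat_vec[of _ m m])
    finally show ?thesis
      using u v0 by (simp add: sol_def)
  qed
  ultimately show False
    using no_zero t by metis
qed

text \<open>The two quadratic terms are the coordinates of a square, index 0 being the real part.
  Coordinate 0 gives the quadric; the other \<open>N - 1\<close> coordinates, an odd number, give
  the pencil after division by 2.\<close>

lemma quadratic_plus_affine_zero:
  fixes A :: "real mat"
  assumes "even N" "N > 0" and A: "A \<in> carrier_mat N N" and r: "r \<in> carrier_vec N"
  shows "\<exists>x \<in> carrier_vec N. (2 * x $ 0) \<cdot>\<^sub>v x - (x \<bullet> x) \<cdot>\<^sub>v unit_vec N 0 + A *\<^sub>v x + r = 0\<^sub>v N"
proof -
  obtain m where m: "N = Suc m" "odd m"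
    using assms(1,2) by (cases N) auto
  define M where "M = mat m m (\<lambda>(i, j). - A $$ (Suc i, Suc j) / 2)"
  define w where "w = vec m (\<lambda>i. - A $$ (Suc i, 0) / 2)"
  define c where "c = vec m (\<lambda>i. - r $ Suc i / 2)"
  define p where "p = vec m (\<lambda>j. A $$ (0, Suc j))"
  obtain a v where v: "v \<in> carrier_vec m" and imag: "a \<cdot>\<^sub>v v = M *\<^sub>v v + (a \<cdot>\<^sub>v w + c)"
    and real: "a\<^sup>2 - v \<bullet> v + A $$ (0, 0) * a + p \<bullet> v + r $ 0 = 0"
    using pencil_quadric_intersect[OF m(2), of M w c p "A $$ (0, 0)" "r $ 0"]
    by (auto simp: M_def w_def c_def p_def)
  define x where "x = vCons a v"
  have x: "x \<in> carrier_vec N"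
    using v by (simp add: x_def m)
  have row: "row A i \<bullet> x = A $$ (i, 0) * a + (\<Sum>j = 0..<m. A $$ (i, Suc j) * v $ j)" if "i < N" for i
    using A v that by (simp add: x_def m scalar_prod_def sum.atLeast0_lessThan_Suc_shift del: sum.op_ivl_Suc)
  have "((2 * x $ 0) \<cdot>\<^sub>v x - (x \<bullet> x) \<cdot>\<^sub>v unit_vec N 0 + A *\<^sub>v x + r) $ i = 0" if i: "i < N" for i
  proof (cases i)
    case 0
    then show ?thesis
      using real A r v x i row[of 0]
      by (simp add: x_def p_def scalar_prod_def[of _ v] power2_eq_square)
  next
    case (Suc k)
    then have k: "k < m"
      using i m by simp
    have "a * v $ k = (\<Sum>j = 0..<m. M $$ (k, j) * v $ j) + (a * w $ k + c $ k)"
      using arg_cong[OF imag, of "\<lambda>y. y $ k"] k v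
      by (simp add: M_def w_def c_def scalar_prod_def)
    also have "\<dots> = - (A $$ (i, 0) * a + (\<Sum>j = 0..<m. A $$ (i, Suc j) * v $ j) + r $ i) / 2"
      using k by (simp add: M_def w_def c_def Suc sum_negf sum_divide_distrib[symmetric] field_simps)
    finally show ?thesis
      using Suc A r v x i row[OF i] by (simp add: x_def m(1) field_simps)
  qed
  then have "(2 * x $ 0) \<cdot>\<^sub>v x - (x \<bullet> x) \<cdot>\<^sub>v unit_vec N 0 + A *\<^sub>v x + r = 0\<^sub>v N"
    using r by (intro eq_vecI) auto
  then show ?thesis
    using x by blast
qed

lemma linear_map_matrix:
  fixes L :: "'a :: comm_ring_1 vec \<Rightarrow> 'a vec"
  assumes carrier: "\<And>x. x \<in> carrier_vec N \<Longrightarrow> L x \<in> carrier_vec M"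
    and add: "\<And>x y. x \<in> carrier_vec N \<Longrightarrow> y \<in> carrier_vec N \<Longrightarrow> L (x + y) = L x + L y"
    and smult: "\<And>c x. x \<in> carrier_vec N \<Longrightarrow> L (c \<cdot>\<^sub>v x) = c \<cdot>\<^sub>v L x"
  shows "\<exists>A \<in> carrier_mat M N. \<forall>x \<in> carrier_vec N. L x = A *\<^sub>v x"
proof
  let ?A = "mat M N (\<lambda>(i, j). L (unit_vec N j) $ i)"
  show "?A \<in> carrier_mat M N"
    by simp
  have "0 \<cdot>\<^sub>v 0\<^sub>v N = (0\<^sub>v N :: 'a vec)"
    by auto
  then have "L (0\<^sub>v N) = 0 \<cdot>\<^sub>v L (0\<^sub>v N)"
    using smult[of "0\<^sub>v N" 0] by simp
  also have "\<dots> = 0\<^sub>v M"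
    using carrier[of "0\<^sub>v N"] by (intro eq_vecI) auto
  finally have zero: "L (0\<^sub>v N) = 0\<^sub>v M" .
  show "\<forall>x \<in> carrier_vec N. L x = ?A *\<^sub>v x"
  proof
    fix x :: "'a vec" assume x: "x \<in> carrier_vec N"
    \<comment> \<open>\<open>t k\<close> keeps the first \<open>k\<close> coordinates of
      \<open>x\<close>, so that linearity can be applied one basis vector at a time.\<close>
    define t where "t k = vec N (\<lambda>j. if j < k then x $ j else 0)" for k
    have t: "t k \<in> carrier_vec N" for k
      by (simp add: t_def)
    have "L (t k) $ i = (\<Sum>j = 0..<k. L (unit_vec N j) $ i * x $ j)" if "k \<le> N" "i < M" for k i
      using that
    proof (induction k)
      case 0
      have "t 0 = 0\<^sub>v N"
        by (auto simp: t_def)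
      then show ?case
        using zero 0 by simp
    next
      case (Suc k)
      have "t (Suc k) = t k + x $ k \<cdot>\<^sub>v unit_vec N k"
        by (intro eq_vecI) (auto simp: t_def unit_vec_def less_Suc_eq)
      then have "L (t (Suc k)) = L (t k) + x $ k \<cdot>\<^sub>v L (unit_vec N k)"
        using t by (simp add: add smult)
      then show ?case
        using Suc carrier[OF t, of k] carrier[of "unit_vec N k"] by (simp add: mult.commute)
    qed
    from this[of N] have "L (t N) $ i = (?A *\<^sub>v x) $ i" if "i < M" for i
      using that x by (simp add: scalar_prod_def)
    moreover have "t N = x"
      using x by (auto simp: t_def)
    ultimately show "L x = ?A *\<^sub>v x"
      using carrier[OF x] by (intro eq_vecI) auto
  qed
qed

subsection \<open>Arithmetic in the Cayley--Dickson algebras\<close>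

text \<open>No membership is assumed: at mismatched subtrees both sides reach the same
  \<open>undefined\<close>.\<close>

lemma cd_add_commute: "x + y = y + (x :: cd)"
  by (induction x y rule: plus_cd.induct) auto

lemma cd_add_interchange:
  assumes "a \<in> cd_alg n" "b \<in> cd_alg n" "c \<in> cd_alg n" "d \<in> cd_alg n"
  shows "(a + b) + (c + d) = (a + c) + (b + d)"
  using assms by (induction n arbitrary: a b c d) fastforce+

lemma cd_uminus_add:
  assumes "a \<in> cd_alg n" "b \<in> cd_alg n"
  shows "- (a + b) = - a + - (b :: cd)"
  using assms by (induction n arbitrary: a b) fastforce+

lemma cd_diff_interchange:
  assumes "a \<in> cd_alg n" "b \<in> cd_alg n" "c \<in> cd_alg n" "d \<in> cd_alg n"
  shows "(a + b) - (c + d) = (a - c) + (b - d)"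
  using assms
  by (simp add: minus_cd_def cd_uminus_add[of c n d] cd_add_interchange[of a n b] cd_uminus_in_cd_alg)

lemma cd_add_zero: "x \<in> cd_alg n \<Longrightarrow> x + cd_zero n = x"
  by (induction n arbitrary: x) auto

lemma cd_zero_add: "x \<in> cd_alg n \<Longrightarrow> cd_zero n + x = x"
  using cd_add_zero cd_add_commute by simp

lemma cd_conj_add:
  assumes "a \<in> cd_alg n" "b \<in> cd_alg n"
  shows "cd_conj (a + b) = cd_conj a + cd_conj b"
  using assms
  by (induction n arbitrary: a b) (auto simp: cd_uminus_add)

lemmas cd_closed = cd_zero_in_cd_alg cd_plus_in_cd_alg cd_uminus_in_cd_alg cd_minus_in_cd_alg
  cd_conj_in_cd_alg cd_times_in_cd_alg

text \<open>Both laws share one induction: the doubled product exchanges left and right in some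
  components, so each law at level \<open>n + 1\<close> uses both at level \<open>n\<close>.\<close>

lemma cd_distrib:
  assumes "x \<in> cd_alg n" "y \<in> cd_alg n" "z \<in> cd_alg n"
  shows "(x + y) * z = x * z + y * z" "z * (x + y) = z * x + z * y"
proof -
  have "(x + y) * z = x * z + y * z \<and> z * (x + y) = z * x + z * y"
    using assms
  proof (induction n arbitrary: x y z)
    case 0
    then show ?case by (auto simp: algebra_simps)
  next
    case (Suc n)
    from Suc.prems obtain x1 x2 y1 y2 z1 z2 where [simp]: "x = Dbl x1 x2" "y = Dbl y1 y2" "z = Dbl z1 z2"
      and mem: "x1 \<in> cd_alg n" "x2 \<in> cd_alg n" "y1 \<in> cd_alg n" "y2 \<in> cd_alg n"
        "z1 \<in> cd_alg n" "z2 \<in> cd_alg n"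
      by auto
    show ?case
      using mem
      by (simp add: Suc.IH cd_conj_add[of _ n] cd_closed cd_diff_interchange[of _ n] cd_add_interchange[of _ n])
  qed
  then show "(x + y) * z = x * z + y * z" "z * (x + y) = z * x + z * y"
    by auto
qed

section \<open>Real scalars\<close>

primrec cd_scale :: "real \<Rightarrow> cd \<Rightarrow> cd" where
  "cd_scale c (Base a) = Base (c * a)"
| "cd_scale c (Dbl q r) = Dbl (cd_scale c q) (cd_scale c r)"

lemma cd_scale_in_cd_alg: "x \<in> cd_alg n \<Longrightarrow> cd_scale c x \<in> cd_alg n"
  by (induction n arbitrary: x) auto

lemma cd_scale_add:
  assumes "x \<in> cd_alg n" "y \<in> cd_alg n"
  shows "cd_scale c (x + y) = cd_scale c x + cd_scale c y"
  using assms by (induction n arbitrary: x y) (auto simp: algebra_simps)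

lemma cd_scale_uminus: "cd_scale c (- x) = - cd_scale c x"
  by (induction x) auto

lemma cd_scale_conj: "cd_scale c (cd_conj x) = cd_conj (cd_scale c x)"
  by (induction x) (auto simp: cd_scale_uminus)

lemma cd_scale_diff:
  assumes "x \<in> cd_alg n" "y \<in> cd_alg n"
  shows "cd_scale c (x - y) = cd_scale c x - cd_scale c y"
  using assms by (simp add: minus_cd_def cd_scale_add[of _ n] cd_closed cd_scale_uminus)

lemma cd_scale_zero: "cd_scale c (cd_zero n) = cd_zero n"
  by (induction n) auto

lemma cd_scale_times:
  assumes "x \<in> cd_alg n" "y \<in> cd_alg n"
  shows "cd_scale c x * y = cd_scale c (x * y)" "x * cd_scale c y = cd_scale c (x * y)"
proof -
  have "cd_scale c x * y = cd_scale c (x * y) \<and> x * cd_scale c y = cd_scale c (x * y)"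
    using assms
  proof (induction n arbitrary: x y)
    case (Suc n)
    then obtain x1 x2 y1 y2 where [simp]: "x = Dbl x1 x2" "y = Dbl y1 y2"
      and mem: "x1 \<in> cd_alg n" "x2 \<in> cd_alg n" "y1 \<in> cd_alg n" "y2 \<in> cd_alg n"
      by auto
    show ?case
      using mem
      by (simp add: Suc.IH cd_scale_add[of _ n] cd_scale_diff[of _ n] cd_closed cd_scale_conj[symmetric])
  qed auto
  then show "cd_scale c x * y = cd_scale c (x * y)" "x * cd_scale c y = cd_scale c (x * y)"
    by auto
qed

section \<open>Embedded reals and real coordinates\<close>

primrec cd_of_real :: "nat \<Rightarrow> real \<Rightarrow> cd" where
  "cd_of_real 0 c = Base c"
| "cd_of_real (Suc n) c = Dbl (cd_of_real n c) (cd_zero n)"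

text \<open>Reading the leaves from left to right puts the real part at index 0.\<close>

primrec cd_coords :: "cd \<Rightarrow> real vec" where
  "cd_coords (Base a) = vec 1 (\<lambda>_. a)"
| "cd_coords (Dbl q r) = cd_coords q @\<^sub>v cd_coords r"

primrec cd_of_coords :: "nat \<Rightarrow> real vec \<Rightarrow> cd" where
  "cd_of_coords 0 v = Base (v $ 0)"
| "cd_of_coords (Suc n) v = Dbl (cd_of_coords n (vec_first v (2 ^ n))) (cd_of_coords n (vec_last v (2 ^ n)))"

lemma cd_coords_carrier: "x \<in> cd_alg n \<Longrightarrow> cd_coords x \<in> carrier_vec (2 ^ n)"
  by (induction n arbitrary: x) (auto simp: mult_2)

lemma cd_of_coords_in_cd_alg: "cd_of_coords n v \<in> cd_alg n"
  by (induction n arbitrary: v) auto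

lemma cd_coords_of_coords: "v \<in> carrier_vec (2 ^ n) \<Longrightarrow> cd_coords (cd_of_coords n v) = v"
proof (induction n arbitrary: v)
  case (Suc n)
  then show ?case by (simp add: mult_2)
qed auto

lemma cd_coords_inject:
  assumes "x \<in> cd_alg n" "y \<in> cd_alg n" "cd_coords x = cd_coords y"
  shows "x = y"
  using assms
proof (induction n arbitrary: x y)
  case 0
  then show ?case by (auto dest: arg_cong[of _ _ "\<lambda>v. v $ 0"])
next
  case (Suc n)
  then obtain x1 x2 y1 y2 where [simp]: "x = Dbl x1 x2" "y = Dbl y1 y2"
    and mem: "x1 \<in> cd_alg n" "x2 \<in> cd_alg n" "y1 \<in> cd_alg n" "y2 \<in> cd_alg n"
    by auto
  show ?case
    using Suc.prems(3) Suc.IH mem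
    by (simp add: append_vec_eq[OF cd_coords_carrier cd_coords_carrier, of _ n])
qed

lemma cd_coords_zero: "cd_coords (cd_zero n) = 0\<^sub>v (2 ^ n)"
  by (induction n) (auto simp: mult_2)

lemma cd_coords_add:
  assumes "x \<in> cd_alg n" "y \<in> cd_alg n"
  shows "cd_coords (x + y) = cd_coords x + cd_coords y"
  using assms
  by (induction n arbitrary: x y)
    (auto simp: append_vec_add[OF cd_coords_carrier cd_coords_carrier cd_coords_carrier cd_coords_carrier])

lemma cd_coords_scale: "cd_coords (cd_scale c x) = c \<cdot>\<^sub>v cd_coords x"
  by (induction x) auto

lemma cd_add_uminus: "x \<in> cd_alg n \<Longrightarrow> x + - x = cd_zero n"
  by (induction n arbitrary: x) auto

lemma cd_uminus_zero: "- cd_zero n = cd_zero n"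
  by (induction n) auto

lemma cd_diff_zero: "x \<in> cd_alg n \<Longrightarrow> x - cd_zero n = x"
  by (simp add: minus_cd_def cd_uminus_zero cd_add_zero)

lemma cd_conj_zero: "cd_conj (cd_zero n) = cd_zero n"
  by (induction n) (auto simp: cd_uminus_zero)

lemma cd_scale_0: "x \<in> cd_alg n \<Longrightarrow> cd_scale 0 x = cd_zero n"
  by (induction n arbitrary: x) auto

text \<open>Homogeneity at the scalar 0: the zero element is 0 times itself, and the scalar moves
  out of the product.\<close>

lemma cd_times_zero:
  assumes "x \<in> cd_alg n"
  shows "x * cd_zero n = cd_zero n" "cd_zero n * x = cd_zero n"
  using cd_scale_times[OF assms cd_zero_in_cd_alg, of 0] cd_scale_times[OF cd_zero_in_cd_alg assms, of 0] assms
  by (simp_all add: cd_scale_0[of _ n] cd_closed cd_scale_zero)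

lemma cd_of_real_in_cd_alg: "cd_of_real n c \<in> cd_alg n"
  by (induction n) (auto simp: cd_closed)

lemma cd_conj_of_real: "cd_conj (cd_of_real n c) = cd_of_real n c"
  by (induction n) (auto simp: cd_uminus_zero)

lemma cd_of_real_add: "cd_of_real n c + cd_of_real n d = cd_of_real n (c + d)"
  by (induction n) (auto simp: cd_add_zero cd_closed)

lemma cd_times_of_real:
  assumes "x \<in> cd_alg n"
  shows "x * cd_of_real n c = cd_scale c x" "cd_of_real n c * x = cd_scale c x"
proof -
  have "x * cd_of_real n c = cd_scale c x \<and> cd_of_real n c * x = cd_scale c x"
    using assms
    by (induction n arbitrary: x)
      (auto simp: cd_conj_of_real cd_conj_zero cd_times_zero cd_diff_zero cd_add_zero cd_zero_add
        cd_closed cd_scale_in_cd_alg)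
  then show "x * cd_of_real n c = cd_scale c x" "cd_of_real n c * x = cd_scale c x"
    by auto
qed

lemma cd_coords_of_real: "cd_coords (cd_of_real n c) = c \<cdot>\<^sub>v unit_vec (2 ^ n) 0"
proof (induction n)
  case (Suc n)
  then show ?case
    by (auto simp: cd_coords_zero mult_2 unit_vec_def)
qed auto

lemma cd_coords_Dbl_0:
  assumes "q \<in> cd_alg n"
  shows "cd_coords (Dbl q r) $ 0 = cd_coords q $ 0"
  using carrier_vecD[OF cd_coords_carrier[OF assms]] by simp

section \<open>Trace, norm and the quadratic identity\<close>

lemma cd_add_conj: "x \<in> cd_alg n \<Longrightarrow> x + cd_conj x = cd_of_real n (2 * cd_coords x $ 0)"
  by (induction n arbitrary: x)
    (auto simp: cd_coords_Dbl_0 cd_add_uminus simp del: cd_coords.simps(2))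

lemma cd_diff_add_add:
  assumes "a \<in> cd_alg n" "b \<in> cd_alg n" "c \<in> cd_alg n"
  shows "(a - b) + (c + b) = a + c"
  using assms
proof (induction n arbitrary: a b c)
  case (Suc n)
  then show ?case by (fastforce simp: minus_cd_def)
qed (auto simp: minus_cd_def)

lemma cd_add_right_cancel:
  assumes "a \<in> cd_alg n" "b \<in> cd_alg n" "c \<in> cd_alg n" "a + c = b + c"
  shows "a = b"
  using assms by (induction n arbitrary: a b c) fastforce+

text \<open>The identity \<open>x^2 - 2 Re(x) x + |x|^2 = 0\<close>, arranged without subtraction.
  It survives every doubling: the induction uses distributivity and the fact that embedded reals act
  as scalars on both sides, never associativity of the product.\<close>

lemma cd_square:
  assumes "x \<in> cd_alg n"
  shows "x * x + cd_of_real n (cd_coords x \<bullet> cd_coords x) = cd_scale (2 * cd_coords x $ 0) x"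
  using assms
proof (induction n arbitrary: x)
  case 0
  then show ?case by (auto simp: scalar_prod_def)
next
  case (Suc n)
  then obtain q r where [simp]: "x = Dbl q r" and mem: "q \<in> cd_alg n" "r \<in> cd_alg n"
    by auto
  let ?N = "\<lambda>x. cd_coords x \<bullet> cd_coords x"
  \<comment> \<open>The induction hypothesis for \<open>r\<close> yields the norm formula: expand
    \<open>(r + cd_conj r) * r\<close>, where the sum is real, and cancel
    \<open>r * r\<close>.\<close>
  have "r * r + cd_conj r * r = cd_of_real n (2 * cd_coords r $ 0) * r"
    using cd_distrib(1)[of r n "cd_conj r" r] mem by (simp add: cd_closed cd_add_conj)
  also have "\<dots> = r * r + cd_of_real n (?N r)"
    using Suc.IH[OF mem(2)] mem by (simp add: cd_times_of_real)
  finally have norm: "cd_conj r * r = cd_of_real n (?N r)"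
    using cd_add_right_cancel[of "cd_conj r * r" n "cd_of_real n (?N r)" "r * r"] mem
    by (simp add: cd_closed cd_of_real_in_cd_alg cd_add_commute)
  have "?N x = ?N q + ?N r"
    using scalar_prod_append[OF cd_coords_carrier cd_coords_carrier cd_coords_carrier cd_coords_carrier] mem
    by simp
  then have "(q * q - cd_conj r * r) + cd_of_real n (?N x) = q * q + cd_of_real n (?N q)"
    using cd_diff_add_add[of "q * q" n "cd_of_real n (?N r)" "cd_of_real n (?N q)"] mem
    by (simp add: norm cd_closed cd_of_real_in_cd_alg flip: cd_of_real_add)
  also have "\<dots> = cd_scale (2 * cd_coords q $ 0) q"
    by (rule Suc.IH[OF mem(1)])
  finally have 1: "(q * q - cd_conj r * r) + cd_of_real n (?N x) = cd_scale (2 * cd_coords q $ 0) q" .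
  \<comment> \<open>Second component of the square: \<open>r\<close> times the real element
    \<open>q + cd_conj q\<close>.\<close>
  have "r * q + r * cd_conj q = cd_scale (2 * cd_coords q $ 0) r"
    using cd_distrib(2)[of q n "cd_conj q" r] mem by (simp add: cd_closed cd_add_conj cd_times_of_real)
  then show ?case
    using 1 mem cd_coords_Dbl_0[OF mem(1), of r]
    by (simp add: cd_add_zero cd_scale_in_cd_alg del: cd_coords.simps(2))
qed

lemma cd_coords_square:
  assumes "x \<in> cd_alg n"
  shows "cd_coords (x * x) =
    (2 * cd_coords x $ 0) \<cdot>\<^sub>v cd_coords x - (cd_coords x \<bullet> cd_coords x) \<cdot>\<^sub>v unit_vec (2 ^ n) 0"
proof -
  define b where "b = (cd_coords x \<bullet> cd_coords x) \<cdot>\<^sub>v (unit_vec (2 ^ n) 0 :: real vec)"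
  have "cd_coords (x * x) + b = (2 * cd_coords x $ 0) \<cdot>\<^sub>v cd_coords x"
    using arg_cong[OF cd_square[OF assms], of cd_coords] assms
    by (simp add: b_def cd_coords_add[of _ n] cd_closed cd_of_real_in_cd_alg cd_coords_of_real cd_coords_scale)
  moreover have "cd_coords (x * x) = cd_coords (x * x) + b - b"
    using cd_coords_carrier[OF cd_times_in_cd_alg[OF assms assms]]
    by (intro eq_vecI) (auto simp: b_def)
  ultimately show ?thesis
    by (simp add: b_def)
qed

subsection \<open>Linear terms\<close>

text \<open>Linearity over the reals: by \<open>cd_scale_times\<close>, real scalars move past
  coefficients on either side in any bracketing.\<close>

definition cd_linear :: "nat \<Rightarrow> (cd \<Rightarrow> cd) \<Rightarrow> bool" where
  "cd_linear n F \<longleftrightarrow> (\<forall>x \<in> cd_alg n. F x \<in> cd_alg n) \<and>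
    (\<forall>x \<in> cd_alg n. \<forall>y \<in> cd_alg n. F (x + y) = F x + F y) \<and>
    (\<forall>c. \<forall>x \<in> cd_alg n. F (cd_scale c x) = cd_scale c (F x))"

text \<open>Both degrees go through one induction, since a product of degree 1 has a constant and a
  linear factor in either order. Products of higher degree satisfy neither premise.\<close>

lemma monomial_eval:
  assumes "monomial n d f"
  shows "d = 0 \<Longrightarrow> \<exists>a \<in> cd_alg n. \<forall>x. gpoly_eval f x = a"
    and "d = 1 \<Longrightarrow> cd_linear n (gpoly_eval f)"
proof -
  have "(d = 0 \<longrightarrow> (\<exists>a \<in> cd_alg n. \<forall>x. gpoly_eval f x = a)) \<and> (d = 1 \<longrightarrow> cd_linear n (gpoly_eval f))"
    using assms
  proof induction
    case (3 d f e g)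
    note hyps = 3
    consider "d = 0" "e = 0" | "d = 0" "e = 1" | "d = 1" "e = 0" | "d + e > 1"
      by linarith
    then show ?case
    proof cases
      case 1
      with hyps show ?thesis by (auto simp: cd_closed)
    next
      case 2
      with hyps show ?thesis
        by (auto simp: cd_linear_def cd_closed cd_distrib[of _ n] cd_scale_times[of _ n])
    next
      case 3
      with hyps show ?thesis
        by (auto simp: cd_linear_def cd_closed cd_distrib[of _ n] cd_scale_times[of _ n])
    qed auto
  qed (auto simp: cd_linear_def)
  then show "d = 0 \<Longrightarrow> \<exists>a \<in> cd_alg n. \<forall>x. gpoly_eval f x = a"
    and "d = 1 \<Longrightarrow> cd_linear n (gpoly_eval f)"
    by auto
qed

lemma cd_linear_gpoly_sum:
  assumes "\<forall>g \<in> set fs. linear_term n g"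
  shows "cd_linear n (gpoly_eval (gpoly_sum n fs))"
  using assms
proof (induction fs)
  case Nil
  then show ?case
    by (simp add: gpoly_sum_def cd_linear_def cd_closed cd_add_zero cd_scale_zero)
next
  case (Cons g fs)
  then have "cd_linear n (gpoly_eval g)" "cd_linear n (gpoly_eval (gpoly_sum n fs))"
    using monomial_eval(2) by (auto simp: linear_term_def)
  then show ?case
    by (simp add: gpoly_sum_def cd_linear_def cd_closed cd_add_interchange[of _ n] cd_scale_add[of _ n])
qed

section \<open>Transfer between the algebra and coordinates\<close>

text \<open>Transporting \<open>F\<close> along the coordinate isomorphism reduces this to
  \<open>linear_map_matrix\<close>; injectivity of \<open>cd_coords\<close> makes its right inverse
  linear and two-sided.\<close>

lemma cd_linear_matrix:
  assumes "cd_linear n F"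
  shows "\<exists>A \<in> carrier_mat (2 ^ n) (2 ^ n). \<forall>x \<in> cd_alg n. cd_coords (F x) = A *\<^sub>v cd_coords x"
proof -
  let ?N = "2 ^ n :: nat"
  let ?X = "cd_of_coords n"
  have F: "\<And>x. x \<in> cd_alg n \<Longrightarrow> F x \<in> cd_alg n"
      "\<And>x y. x \<in> cd_alg n \<Longrightarrow> y \<in> cd_alg n \<Longrightarrow> F (x + y) = F x + F y"
      "\<And>c x. x \<in> cd_alg n \<Longrightarrow> F (cd_scale c x) = cd_scale c (F x)"
    using assms by (auto simp: cd_linear_def)
  note X = cd_of_coords_in_cd_alg
  have "?X (u + v) = ?X u + ?X v" if "u \<in> carrier_vec ?N" "v \<in> carrier_vec ?N" for u v
    by (rule cd_coords_inject[of _ n])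
      (use that in \<open>simp_all add: X cd_closed cd_coords_add[OF X X] cd_coords_of_coords\<close>)
  moreover have "?X (c \<cdot>\<^sub>v v) = cd_scale c (?X v)" if "v \<in> carrier_vec ?N" for c v
    by (rule cd_coords_inject[of _ n])
      (use that in \<open>simp_all add: X cd_scale_in_cd_alg cd_coords_scale cd_coords_of_coords\<close>)
  ultimately obtain A where A: "A \<in> carrier_mat ?N ?N"
    and eq: "\<And>v. v \<in> carrier_vec ?N \<Longrightarrow> cd_coords (F (?X v)) = A *\<^sub>v v"
    using linear_map_matrix[of ?N "\<lambda>v. cd_coords (F (?X v))" ?N]
    by (auto simp: X F cd_coords_carrier cd_coords_add[of _ n] cd_coords_scale)
  have "?X (cd_coords x) = x" if "x \<in> cd_alg n" for x
    using that by (intro cd_coords_inject[of _ n]) (simp_all add: X cd_coords_of_coords cd_coords_carrier)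
  then show ?thesis
    using A eq[OF cd_coords_carrier] by metis
qed

theorem theorem4p6:
  fixes n :: nat and f :: gpoly
  assumes "n \<ge> 1" and "monic_quadratic n f"
  shows "\<exists>x \<in> cd_alg n. gpoly_eval f x = cd_zero n"
proof -
  obtain fs r where fs: "\<forall>g \<in> set fs. linear_term n g" and r: "r \<in> cd_alg n"
    and f: "f = Plus (Plus (Times Var Var) (gpoly_sum n fs)) (Coeff r)"
    using assms(2) by (auto simp: monic_quadratic_def)
  let ?F = "gpoly_eval (gpoly_sum n fs)"
  have lin: "cd_linear n ?F"
    by (rule cd_linear_gpoly_sum[OF fs])
  then have F: "?F x \<in> cd_alg n" if "x \<in> cd_alg n" for x
    using that by (simp add: cd_linear_def)
  obtain A where A: "A \<in> carrier_mat (2 ^ n) (2 ^ n)"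
    and A_eq: "\<And>x. x \<in> cd_alg n \<Longrightarrow> cd_coords (?F x) = A *\<^sub>v cd_coords x"
    using cd_linear_matrix[OF lin] by blast
  \<comment> \<open>Here \<open>n \<ge> 1\<close> makes the dimension \<open>2 ^ n\<close> even;
    over the reals themselves \<open>x^2 + 1\<close> has no zero.\<close>
  obtain v where v: "v \<in> carrier_vec (2 ^ n)"
    and zero: "(2 * v $ 0) \<cdot>\<^sub>v v - (v \<bullet> v) \<cdot>\<^sub>v unit_vec (2 ^ n) 0 + A *\<^sub>v v + cd_coords r = 0\<^sub>v (2 ^ n)"
    using quadratic_plus_affine_zero[OF _ _ A cd_coords_carrier[OF r]] assms(1) by auto
  define x where "x = cd_of_coords n v"
  have x: "x \<in> cd_alg n" and v_eq: "v = cd_coords x"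
    using v by (simp_all add: x_def cd_of_coords_in_cd_alg cd_coords_of_coords)
  have "gpoly_eval f x = cd_zero n"
  proof (rule cd_coords_inject[of _ n])
    show "cd_coords (gpoly_eval f x) = cd_coords (cd_zero n)"
      using zero x r F
      by (simp add: f v_eq cd_coords_add[of _ n] cd_closed A_eq cd_coords_square cd_coords_zero)
  qed (use x r F in \<open>simp_all add: f cd_closed\<close>)
  then show ?thesis
    using x by blast
qed

end
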